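(* Let $[S,f],[S',f']\in\mathcal{T}(n)$, with $S=\mathbb{R}^n/\Lambda$ and $S'=\mathbb{R}^n/\Lambda'$. The map $\psi:S\to S'$ (in the homotopy class $[f'^{-1}\circ f]$) which lifts to the unique affine map $\tilde\psi:\mathbb{R}^n\to\mathbb{R}^n$ realizes the minimal Lipschitz constant in $[f'^{-1}\circ f]$.
   Context: Let $n\ge2$ and $\mathbb{T}^n=\mathbb{R}^n/\mathbb{Z}^n$. $\mathcal{T}(n)$ is the set of classes $[S,f]$, where $S$ is a flat $n$-torus of volume 1 and $f:S\to\mathbb{T}^n$ is an orientation-preserving homeomorphism; $[S,f]=[S',f']$ iff there is an isometry $h:S\to S'$ with $f'\circ h$ homotopic to $f$. $[f'^{-1}\circ f]$ denotes the homotopy class of $f'^{-1}\circ f:S\to S'$. The Lipschitz constant of $\phi:S\to S'$ is $\mathcal{L}(\phi)=\sup_{x\ne y}d_{S'}(\phi(x),\phi(y))/d_S(x,y)$, with $d_S,d_{S'}$ the flat distances. *)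

theory Defs
  imports "HOL-Analysis.Analysis" "HOL-Homology.Homology"
begin

section \<open>Lattices and flat tori\<close>

definition int_vecs :: "(real ^ 'n) set" where
  "int_vecs = {x. \<forall>i. x $ i \<in> \<int>}"

text \<open>The columns of \<open>A\<close> are a \<open>\<int>\<close>-basis of \<open>\<Lambda>\<close>.\<close>

definition lattice_basis :: "real ^ 'n ^ 'n \<Rightarrow> (real ^ 'n) set \<Rightarrow> bool" where
  "lattice_basis A \<Lambda> \<longleftrightarrow> invertible A \<and> \<Lambda> = (\<lambda>z. A *v z) ` int_vecs"

text \<open>The volume of \<open>\<real>\<^sup>n/\<Lambda>\<close> is the Lebesgue measure of a fundamental parallelepiped; it does
  not depend on the choice of the basis.\<close>

definition unit_volume_lattice :: "(real ^ 'n) set \<Rightarrow> bool" where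
  "unit_volume_lattice \<Lambda> \<longleftrightarrow>
     (\<exists>A. lattice_basis A \<Lambda> \<and>
          measure lebesgue ((\<lambda>v. A *v v) ` {v. \<forall>i. 0 \<le> v $ i \<and> v $ i < 1}) = 1)"

definition torus_point :: "(real ^ 'n) set \<Rightarrow> real ^ 'n \<Rightarrow> (real ^ 'n) set" where
  "torus_point \<Lambda> x = (\<lambda>l. x + l) ` \<Lambda>"

definition torus :: "(real ^ 'n) set \<Rightarrow> (real ^ 'n) set set" where
  "torus \<Lambda> = range (torus_point \<Lambda>)"

definition torus_topology :: "(real ^ 'n) set \<Rightarrow> (real ^ 'n) set topology" where
  "torus_topology \<Lambda> = topology (\<lambda>U. U \<subseteq> torus \<Lambda> \<and> open (torus_point \<Lambda> -` U))"

lemma openin_torus_topology: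
  "openin (torus_topology \<Lambda>) U \<longleftrightarrow> U \<subseteq> torus \<Lambda> \<and> open (torus_point \<Lambda> -` U)"
proof -
  have "istopology (\<lambda>U. U \<subseteq> torus \<Lambda> \<and> open (torus_point \<Lambda> -` U))"
    by (auto simp: istopology_def vimage_Union)
  then show ?thesis
    by (simp add: torus_topology_def topology_inverse')
qed

lemma topspace_torus_topology [simp]: "topspace (torus_topology \<Lambda>) = torus \<Lambda>"
proof -
  have "torus_point \<Lambda> -` torus \<Lambda> = UNIV"
    by (auto simp: torus_def)
  then have "openin (torus_topology \<Lambda>) (torus \<Lambda>)"
    by (simp add: openin_torus_topology)
  then show ?thesis
    by (metis openin_subset openin_topspace openin_torus_topology subset_antisym)
qed

lemma quotient_map_torus_point: "quotient_map euclidean (torus_topology \<Lambda>) (torus_point \<Lambda>)"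
  by (auto simp: quotient_map_def openin_torus_topology torus_def vimage_def)

text \<open>The flat distance on \<open>\<real>\<^sup>n/\<Lambda>\<close>: since points are cosets, it is the Euclidean distance between
  them as subsets of \<open>\<real>\<^sup>n\<close>, i.e. the infimum of the distances between representatives.\<close>

abbreviation torus_dist :: "(real ^ 'n) set \<Rightarrow> (real ^ 'n) set \<Rightarrow> real" where
  "torus_dist \<equiv> setdist"

definition torus_isometry ::
    "(real ^ 'n) set \<Rightarrow> (real ^ 'n) set \<Rightarrow> ((real ^ 'n) set \<Rightarrow> (real ^ 'n) set) \<Rightarrow> bool" where
  "torus_isometry \<Lambda> \<Lambda>' h \<longleftrightarrow>
     bij_betw h (torus \<Lambda>) (torus \<Lambda>') \<and>
     (\<forall>p\<in>torus \<Lambda>. \<forall>q\<in>torus \<Lambda>. torus_dist (h p) (h q) = torus_dist p q)"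

definition lifts_to ::
    "(real ^ 'n) set \<Rightarrow> (real ^ 'n) set \<Rightarrow> ((real ^ 'n) set \<Rightarrow> (real ^ 'n) set) \<Rightarrow>
     (real ^ 'n \<Rightarrow> real ^ 'n) \<Rightarrow> bool" where
  "lifts_to \<Lambda> \<Lambda>' \<phi> F \<longleftrightarrow>
     continuous_on UNIV F \<and> (\<forall>x. \<phi> (torus_point \<Lambda> x) = torus_point \<Lambda>' (F x))"


section \<open>Marked flat tori\<close>

text \<open>Flat tori carry the orientation of \<open>\<real>\<^sup>n\<close>. A homeomorphism between them preserves it if it maps
  local orientations to local orientations. In terms of a lift \<open>F\<close>, and after using translations
  to identify each local homology group of \<open>\<real>\<^sup>n\<close> with the one at the origin, this says that
  \<open>v \<mapsto> F (x + v) - F x\<close> acts as the identity on \<open>H\<^sub>n(\<real>\<^sup>n, \<real>\<^sup>n - {0})\<close>.\<close>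

definition orientation_preserving ::
    "(real ^ 'n) set \<Rightarrow> (real ^ 'n) set \<Rightarrow> ((real ^ 'n) set \<Rightarrow> (real ^ 'n) set) \<Rightarrow> bool" where
  "orientation_preserving \<Lambda> \<Lambda>' f \<longleftrightarrow>
     (\<exists>F. lifts_to \<Lambda> \<Lambda>' f F \<and>
        (\<forall>x. \<forall>c \<in> carrier (relative_homology_group (int CARD('n))
                            (euclidean :: (real ^ 'n) topology) (- {0})).
           hom_induced (int CARD('n)) euclidean (- {0}) euclidean (- {0})
             (\<lambda>v. F (x + v) - F x) c = c))"

text \<open>A pair \<open>(\<Lambda>, f)\<close> stands for \<open>f : \<real>\<^sup>n/\<Lambda> \<rightarrow> \<real>\<^sup>n/\<int>\<^sup>n\<close>; only the values of \<open>f\<close> on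
  \<open>torus \<Lambda>\<close> matter.\<close>

type_synonym 'n marked = "(real ^ 'n) set \<times> ((real ^ 'n) set \<Rightarrow> (real ^ 'n) set)"

definition marked_tori :: "'n::finite marked set" where
  "marked_tori =
     {(\<Lambda>, f). unit_volume_lattice \<Lambda> \<and>
              homeomorphic_map (torus_topology \<Lambda>) (torus_topology int_vecs) f \<and>
              orientation_preserving \<Lambda> int_vecs f}"

definition marking_equiv :: "'n::finite marked rel" where
  "marking_equiv =
     {((\<Lambda>, f), (\<Lambda>', f')). (\<Lambda>, f) \<in> marked_tori \<and> (\<Lambda>', f') \<in> marked_tori \<and>
        (\<exists>h. torus_isometry \<Lambda> \<Lambda>' h \<and>
             homotopic_with (\<lambda>_. True) (torus_topology \<Lambda>) (torus_topology int_vecs) (f' \<circ> h) f)}"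

definition teichmueller_space :: "'n::finite marked set set" where
  "teichmueller_space = marked_tori // marking_equiv"

text \<open>The homotopy class \<open>[f'\<^sup>-\<^sup>1 \<circ> f]\<close> of maps \<open>\<real>\<^sup>n/\<Lambda> \<rightarrow> \<real>\<^sup>n/\<Lambda>'\<close>.\<close>

definition change_of_marking :: "'n::finite marked \<Rightarrow> 'n marked \<Rightarrow>
    ((real ^ 'n) set \<Rightarrow> (real ^ 'n) set) set" where
  "change_of_marking = (\<lambda>(\<Lambda>, f) (\<Lambda>', f').
     {\<phi>. homotopic_with (\<lambda>_. True) (torus_topology \<Lambda>) (torus_topology \<Lambda>')
           (inv_into (torus \<Lambda>') f' \<circ> f) \<phi>})"


section \<open>Lipschitz constants and affine maps\<close>

text \<open>The supremum is taken in \<open>[0, \<infinity>]\<close>, so that it makes sense for every map.\<close>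

definition lipschitz_const ::
    "(real ^ 'n) set \<Rightarrow> ((real ^ 'n) set \<Rightarrow> (real ^ 'n) set) \<Rightarrow> ennreal" where
  "lipschitz_const \<Lambda> \<phi> =
     (SUP (p, q) \<in> {(p, q). p \<in> torus \<Lambda> \<and> q \<in> torus \<Lambda> \<and> p \<noteq> q}.
        ennreal (torus_dist (\<phi> p) (\<phi> q) / torus_dist p q))"

definition affine_map :: "(real ^ 'n \<Rightarrow> real ^ 'n) \<Rightarrow> bool" where
  "affine_map F \<longleftrightarrow> (\<exists>A b. F = (\<lambda>x. A *v x + b))"

end

theory Submission
  imports Defs
begin

text \<open>Lift a map \<open>\<phi>\<close> of tori to \<open>F\<close> on \<open>\<real>\<^sup>n\<close>. The translation differences
  \<open>F (x + l) - F x\<close> lie in the discrete set \<open>\<Lambda>'\<close>, so they do not depend on \<open>x\<close> and are invariant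
  under homotopy; they are additive in \<open>l\<close>, hence given by a matrix \<open>A\<close>. Straight-line homotopies
  show that \<open>A x + b\<close> descends to a map in the same class, and \<open>A\<close> is determined by the class.
  If \<open>\<phi>\<close> has Lipschitz constant \<open>L\<close>, so has \<open>F\<close>, and then \<open>\<bar>A l\<bar> = \<bar>F l - F 0\<bar> \<le> L \<bar>l\<bar>\<close> for
  lattice vectors \<open>l\<close>; by homogeneity and density this bound holds for all vectors.\<close>

section \<open>Lattices\<close>

lemma int_vecs_add: "x \<in> int_vecs \<Longrightarrow> y \<in> int_vecs \<Longrightarrow> x + y \<in> int_vecs"
  by (simp add: int_vecs_def)

lemma int_vecs_uminus: "x \<in> int_vecs \<Longrightarrow> - x \<in> int_vecs"
  by (simp add: int_vecs_def)

text \<open>The standard basis vectors generate the integer vectors as a group. This rule later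
  spreads an additive identity from a lattice basis to the whole lattice.\<close>

lemma int_vecs_induct [consumes 1, case_names axis add uminus]:
  fixes z :: "real ^ 'n"
  assumes z: "z \<in> int_vecs"
    and axis: "\<And>i. P (axis i 1)"
    and add: "\<And>x y. P x \<Longrightarrow> P y \<Longrightarrow> P (x + y)"
    and uminus: "\<And>x. P x \<Longrightarrow> P (- x)"
  shows "P z"
proof -
  \<comment> \<open>Zero arises as a basis vector plus its negative; \<open>undefined\<close> is
    just some index.\<close>
  have zero: "P 0"
    using add[OF axis[of undefined] uminus[OF axis[of undefined]]] by simp
  have nat: "P (real k *\<^sub>R axis i 1)" for k i
    by (induction k) (auto simp: zero algebra_simps intro: add axis)
  have int: "P (c *\<^sub>R axis i 1)" if c: "c \<in> \<int>" for c i
  proof -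
    obtain k where k: "c = of_int k"
      using c by (rule Ints_cases)
    show ?thesis
    proof (cases k)
      case (nonneg n)
      then show ?thesis
        using nat[of n i] k by simp
    next
      case (neg n)
      then show ?thesis
        using uminus[OF nat[of "Suc n" i]] k by (simp del: of_nat_Suc flip: scaleR_minus_left)
    qed
  qed
  have "P (\<Sum>i\<in>I. z $ i *\<^sub>R axis i 1)" if "finite I" for I
    using that
  proof (induction I)
    case empty
    show ?case by (simp add: zero)
  next
    case (insert i I)
    have "z $ i \<in> \<int>"
      using z by (simp add: int_vecs_def)
    then show ?case
      using insert add[OF int[of "z $ i" i] insert.IH] by simp
  qed
  from this[of UNIV] show ?thesis
    by (metis (no_types, lifting) basis_expansion finite scalar_mult_eq_scaleR sum.cong)
qed

lemma lattice_basis_add: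
  assumes "lattice_basis B \<Lambda>" "x \<in> \<Lambda>" "y \<in> \<Lambda>"
  shows "x + y \<in> \<Lambda>"
proof -
  obtain u v where "u \<in> int_vecs" "v \<in> int_vecs" "x = B *v u" "y = B *v v"
    using assms by (auto simp: lattice_basis_def)
  then have "x + y = B *v (u + v)" "u + v \<in> int_vecs"
    by (simp_all add: matrix_vector_right_distrib int_vecs_add)
  then show ?thesis
    using assms(1) by (auto simp: lattice_basis_def)
qed

lemma lattice_basis_uminus:
  assumes "lattice_basis B \<Lambda>" "x \<in> \<Lambda>"
  shows "- x \<in> \<Lambda>"
proof -
  obtain u where "u \<in> int_vecs" "x = B *v u"
    using assms by (auto simp: lattice_basis_def)
  then have "- x = B *v (- u)" "- u \<in> int_vecs"
    by (simp_all add: int_vecs_uminus vec.neg)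
  then show ?thesis
    using assms(1) by (auto simp: lattice_basis_def)
qed

lemma lattice_basis_diff:
  assumes "lattice_basis B \<Lambda>" "x \<in> \<Lambda>" "y \<in> \<Lambda>"
  shows "x - y \<in> \<Lambda>"
  using lattice_basis_add[OF assms(1,2) lattice_basis_uminus[OF assms(1,3)]] by simp

lemma lattice_basis_zero:
  assumes "lattice_basis B \<Lambda>"
  shows "0 \<in> \<Lambda>"
proof -
  have "(0 :: real ^ 'a) \<in> int_vecs"
    by (simp add: int_vecs_def)
  then have "B *v 0 \<in> \<Lambda>"
    using assms unfolding lattice_basis_def by blast
  then show ?thesis by simp
qed

text \<open>\<open>C\<close> computes coordinates in the lattice basis, so questions of discreteness
  become questions about integers.\<close>

lemma lattice_basis_inverse:
  assumes "lattice_basis B \<Lambda>"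
  obtains C where "\<And>x. B *v (C *v x) = x" "\<And>x. C *v (B *v x) = x"
    "\<And>x. x \<in> \<Lambda> \<longleftrightarrow> C *v x \<in> int_vecs"
proof -
  obtain C where C: "B ** C = mat 1" "C ** B = mat 1"
    using assms unfolding lattice_basis_def invertible_def by blast
  have *: "B *v (C *v x) = x" "C *v (B *v x) = x" for x
    using C by (simp_all add: matrix_vector_mul_assoc)
  have "x \<in> \<Lambda> \<longleftrightarrow> C *v x \<in> int_vecs" for x
    using assms * unfolding lattice_basis_def by (metis image_iff)
  with * show ?thesis using that by blast
qed

text \<open>A nonzero integer vector has norm at least 1, and the injective linear map
  \<open>B\<close> shrinks norms by at most a fixed positive factor.\<close>

lemma lattice_min_norm:
  assumes "lattice_basis B \<Lambda>"
  obtains e where "e > 0" "\<And>l. l \<in> \<Lambda> \<Longrightarrow> l \<noteq> 0 \<Longrightarrow> e \<le> norm l"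
proof -
  obtain C where C: "\<And>x. B *v (C *v x) = x" "\<And>x. C *v (B *v x) = x"
    "\<And>x. x \<in> \<Lambda> \<longleftrightarrow> C *v x \<in> int_vecs"
    using lattice_basis_inverse[OF assms] by blast
  have "inj ((*v) B)"
    by (metis C(2) injI)
  then obtain e where e: "e > 0" "\<And>x. e * norm x \<le> norm (B *v x)"
    using linear_inj_bounded_below_pos[OF matrix_vector_mul_linear[of B]] by blast
  have "e \<le> norm l" if l: "l \<in> \<Lambda>" "l \<noteq> 0" for l
  proof -
    have z: "C *v l \<in> int_vecs" "C *v l \<noteq> 0"
      using C l by (auto, metis matrix_vector_mult_0_right)
    then obtain i where i: "(C *v l) $ i \<noteq> 0" "(C *v l) $ i \<in> \<int>"
      by (auto simp: int_vecs_def vec_eq_iff)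
    have "1 \<le> \<bar>(C *v l) $ i\<bar>"
      using i Ints_nonzero_abs_ge1 by blast
    also have "\<dots> \<le> norm (C *v l)"
      by (rule component_le_norm_cart)
    finally have "e * 1 \<le> e * norm (C *v l)"
      using e(1) by (intro mult_left_mono) auto
    also have "\<dots> \<le> norm l"
      using e(2)[of "C *v l"] C(1) by simp
    finally show ?thesis by simp
  qed
  then show ?thesis using that e(1) by blast
qed

text \<open>In lattice coordinates each component is a continuous integer-valued function, and
  distinct integers are at least 1 apart.\<close>

lemma continuous_into_lattice_constant:
  fixes f :: "'a::topological_space \<Rightarrow> real ^ 'n"
  assumes B: "lattice_basis B \<Lambda>" and S: "connected S" and f: "continuous_on S f"
    and im: "f ` S \<subseteq> \<Lambda>" and xy: "x \<in> S" "y \<in> S"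
  shows "f x = f y"
proof -
  obtain C where C: "\<And>x. B *v (C *v x) = x" "\<And>x. C *v (B *v x) = x"
    "\<And>x. x \<in> \<Lambda> \<longleftrightarrow> C *v x \<in> int_vecs"
    using lattice_basis_inverse[OF B] by blast
  have int: "(C *v f u) $ i \<in> \<int>" if "u \<in> S" for u i
    using C(3)[of "f u"] im that by (auto simp: int_vecs_def)
  have "(C *v f x) $ i = (C *v f y) $ i" for i
  proof -
    have "(\<lambda>u. (C *v f u) $ i) constant_on S"
    proof (rule continuous_discrete_range_constant[OF S])
      show "continuous_on S (\<lambda>u. (C *v f u) $ i)"
        by (intro continuous_intros f matrix_vector_mult_linear_continuous_on
            continuous_on_compose2[OF matrix_vector_mult_linear_continuous_on f]) auto
      show "\<exists>e>0. \<forall>v. v \<in> S \<and> (C *v f v) $ i \<noteq> (C *v f u) $ i \<longrightarrow>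
          e \<le> norm ((C *v f v) $ i - (C *v f u) $ i)" if "u \<in> S" for u
        using int[OF that] int
        by (intro exI[of _ 1]) (auto intro!: Ints_nonzero_abs_ge1 Ints_diff)
    qed
    then show ?thesis
      using xy by (auto simp: constant_on_def)
  qed
  then have "C *v f x = C *v f y"
    by (simp add: vec_eq_iff)
  then show ?thesis by (metis C(1))
qed

section \<open>Flat tori\<close>

lemma torus_point_eq_iff:
  assumes "lattice_basis B \<Lambda>"
  shows "torus_point \<Lambda> x = torus_point \<Lambda> y \<longleftrightarrow> x - y \<in> \<Lambda>"
proof
  assume "torus_point \<Lambda> x = torus_point \<Lambda> y"
  moreover have "x + 0 \<in> torus_point \<Lambda> x"
    unfolding torus_point_def using lattice_basis_zero[OF assms] by (rule imageI)
  ultimately obtain l where "x = y + l" "l \<in> \<Lambda>"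
    by (auto simp: torus_point_def)
  then show "x - y \<in> \<Lambda>" by simp
next
  have sub: "torus_point \<Lambda> x \<subseteq> torus_point \<Lambda> y" if "x - y \<in> \<Lambda>" for x y
  proof
    fix u assume "u \<in> torus_point \<Lambda> x"
    then obtain l where l: "u = x + l" "l \<in> \<Lambda>"
      by (auto simp: torus_point_def)
    then have "u = y + ((x - y) + l)" "(x - y) + l \<in> \<Lambda>"
      using lattice_basis_add[OF assms that] by auto
    then show "u \<in> torus_point \<Lambda> y"
      unfolding torus_point_def by blast
  qed
  assume "x - y \<in> \<Lambda>"
  moreover from this have "y - x \<in> \<Lambda>"
    using lattice_basis_uminus[OF assms] by fastforce
  ultimately show "torus_point \<Lambda> x = torus_point \<Lambda> y"
    using sub by blast
qed

lemma torus_point_add_lattice: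
  assumes "lattice_basis B \<Lambda>" "l \<in> \<Lambda>"
  shows "torus_point \<Lambda> (x + l) = torus_point \<Lambda> x"
  using assms by (simp add: torus_point_eq_iff)

lemma torus_dist_le_dist:
  assumes "lattice_basis B \<Lambda>"
  shows "torus_dist (torus_point \<Lambda> x) (torus_point \<Lambda> y) \<le> dist x y"
proof (rule setdist_le_dist)
  show "x \<in> torus_point \<Lambda> x" "y \<in> torus_point \<Lambda> y"
    unfolding torus_point_def using lattice_basis_zero[OF assms] by force+
qed

lemma torus_dist_eq_dist_local:
  assumes "lattice_basis B \<Lambda>"
  obtains e where "e > 0"
    "\<And>x y. dist x y \<le> e \<Longrightarrow> torus_dist (torus_point \<Lambda> x) (torus_point \<Lambda> y) = dist x y"
proof -
  obtain e where e: "e > 0" "\<And>l. l \<in> \<Lambda> \<Longrightarrow> l \<noteq> 0 \<Longrightarrow> e \<le> norm l"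
    using lattice_min_norm[OF assms] by blast
  \<comment> \<open>Half the minimal length is the right scale: shifting the two points by different
    lattice vectors leaves them at least \<open>e - e / 2\<close> apart.\<close>
  have "torus_dist (torus_point \<Lambda> x) (torus_point \<Lambda> y) = dist x y" if d: "dist x y \<le> e / 2" for x y
  proof (rule antisym[OF torus_dist_le_dist[OF assms]])
    show "dist x y \<le> torus_dist (torus_point \<Lambda> x) (torus_point \<Lambda> y)"
    proof (rule le_setdistI)
      show "torus_point \<Lambda> x \<noteq> {}" "torus_point \<Lambda> y \<noteq> {}"
        using lattice_basis_zero[OF assms] by (auto simp: torus_point_def)
      fix u v assume "u \<in> torus_point \<Lambda> x" "v \<in> torus_point \<Lambda> y"
      then obtain l m where lm: "u = x + l" "v = y + m" "l \<in> \<Lambda>" "m \<in> \<Lambda>"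
        by (auto simp: torus_point_def)
      show "dist x y \<le> dist u v"
      proof (cases "l = m")
        case False
        then have "e \<le> norm (l - m)"
          using e(2)[OF lattice_basis_diff[OF assms lm(3,4)]] by simp
        also have "l - m = (u - v) - (x - y)"
          using lm by simp
        also have "norm \<dots> \<le> norm (u - v) + norm (x - y)"
          by (rule norm_triangle_ineq4)
        finally show ?thesis
          using d by (simp add: dist_norm)
      qed (simp add: lm)
    qed
  qed
  then show ?thesis
    using that[of "e / 2"] e(1) by simp
qed

text \<open>A continuous map into \<open>\<real>\<^sup>n/\<Lambda>\<close> is lifted coordinatewise, as a logarithm of its composition
  with the characters \<open>x \<mapsto> exp (2\<pi>i x\<^sub>j)\<close>, where \<open>x\<^sub>j\<close> are the coordinates in the lattice basis.\<close>

lemma torus_lift_exists: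
  fixes h :: "'a::real_normed_vector \<Rightarrow> (real ^ 'n) set"
  assumes B: "lattice_basis B \<Lambda>" and S: "contractible S"
    and h: "continuous_map (top_of_set S) (torus_topology \<Lambda>) h"
  obtains H where "continuous_on S H" "\<And>x. x \<in> S \<Longrightarrow> h x = torus_point \<Lambda> (H x)"
proof -
  obtain C where C: "\<And>x. B *v (C *v x) = x" "\<And>x. C *v (B *v x) = x"
    "\<And>x. x \<in> \<Lambda> \<longleftrightarrow> C *v x \<in> int_vecs"
    using lattice_basis_inverse[OF B] by blast
  define E where "E i x = exp (2 * of_real pi * \<i> * of_real ((C *v x) $ i))" for i x
  have E_cont: "continuous_on UNIV (E i)" for i
    unfolding E_def by (intro continuous_intros matrix_vector_mult_linear_continuous_on)
  have E_eq: "E i x = E i y" if "torus_point \<Lambda> x = torus_point \<Lambda> y" for i x y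
  proof -
    have "C *v (x - y) \<in> int_vecs"
      using that C(3) torus_point_eq_iff[OF B] by blast
    then have "(C *v x) $ i - (C *v y) $ i \<in> \<int>"
      by (simp add: int_vecs_def matrix_vector_mult_diff_distrib)
    then obtain k where "(C *v x) $ i - (C *v y) $ i = of_int k"
      using Ints_cases by blast
    then have "(C *v x) $ i = (C *v y) $ i + of_int k"
      by linarith
    then show ?thesis
      unfolding E_def exp_eq by (intro exI[of _ k]) (simp add: algebra_simps)
  qed
  \<comment> \<open>The character \<open>E i\<close> is periodic, so it factors through the torus as
    \<open>q\<close>; then \<open>q \<circ> h\<close> has no zeros and admits a logarithm on the
    contractible set \<open>S\<close>.\<close>
  have "\<exists>L. continuous_on S L \<and> (\<forall>s\<in>S. \<forall>y. h s = torus_point \<Lambda> y \<longrightarrow> E i y = exp (L s))" for i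
  proof -
    obtain q where q: "continuous_map (torus_topology \<Lambda>) euclidean q"
        "\<And>x. q (torus_point \<Lambda> x) = E i x"
      using quotient_map_lift_exists[OF quotient_map_torus_point[of \<Lambda>], of euclidean "E i"]
        E_cont E_eq by (metis UNIV_I continuous_map_iff_continuous2 topspace_euclidean)
    have "continuous_on S (q \<circ> h)"
      using continuous_map_compose[OF h q(1)] by simp
    moreover have "(q \<circ> h) s \<noteq> 0" if "s \<in> S" for s
    proof -
      have "h s \<in> torus \<Lambda>"
        using h that by (auto simp: continuous_map_def)
      then obtain y where "h s = torus_point \<Lambda> y"
        by (auto simp: torus_def)
      then show ?thesis by (simp add: q(2) E_def)
    qed
    ultimately obtain L where "continuous_on S L" "\<And>s. s \<in> S \<Longrightarrow> (q \<circ> h) s = exp (L s)"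
      using continuous_logarithm_on_contractible[OF _ S] by blast
    then show ?thesis
      using q(2) by (metis comp_apply)
  qed
  then obtain L where L: "\<And>i. continuous_on S (L i)"
      "\<And>i s y. s \<in> S \<Longrightarrow> h s = torus_point \<Lambda> y \<Longrightarrow> E i y = exp (L i s)"
    by metis
  \<comment> \<open>The imaginary part of the logarithm is 2 pi times the coordinate, up to an
    integer multiple of 2 pi; that ambiguity is a lattice vector.\<close>
  define H where "H s = B *v (\<chi> i. Im (L i s) / (2 * pi))" for s
  show thesis
  proof
    have "continuous_on S (\<lambda>s. \<chi> i. Im (L i s) / (2 * pi))"
      by (intro continuous_intros L(1)) auto
    then show "continuous_on S H"
      unfolding H_def
      by (rule continuous_on_compose2[OF matrix_vector_mult_linear_continuous_on]) auto
    fix s assume s: "s \<in> S"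
    then have "h s \<in> torus \<Lambda>"
      using h by (auto simp: continuous_map_def)
    then obtain y where y: "h s = torus_point \<Lambda> y"
      by (auto simp: torus_def)
    have "(C *v (y - H s)) $ i \<in> \<int>" for i
    proof -
      from L(2)[OF s y, of i] obtain k :: int
        where k: "2 * of_real pi * \<i> * of_real ((C *v y) $ i) = L i s + (of_int (2 * k) * pi) * \<i>"
        unfolding E_def exp_eq by blast
      from arg_cong[OF k, of Im] have "2 * pi * (C *v y) $ i = Im (L i s) + of_int (2 * k) * pi"
        by simp
      then have "(C *v y) $ i = Im (L i s) / (2 * pi) + of_int k"
        by (simp add: field_simps)
      then show ?thesis
        by (simp add: matrix_vector_mult_diff_distrib H_def C(2))
    qed
    then have "y - H s \<in> \<Lambda>"
      unfolding C(3) by (simp add: int_vecs_def)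
    then show "h s = torus_point \<Lambda> (H s)"
      using y torus_point_eq_iff[OF B] by blast
  qed
qed

section \<open>Translation differences of lifts and their homotopy invariance\<close>

lemma lifts_to_translate_diff:
  assumes B: "lattice_basis B \<Lambda>" and B': "lattice_basis B' \<Lambda>'"
    and F: "lifts_to \<Lambda> \<Lambda>' \<phi> F" and l: "l \<in> \<Lambda>"
  shows "F (x + l) - F x \<in> \<Lambda>'"
proof -
  have "torus_point \<Lambda>' (F (x + l)) = torus_point \<Lambda>' (F x)"
    using F torus_point_add_lattice[OF B l] unfolding lifts_to_def by metis
  then show ?thesis
    by (simp add: torus_point_eq_iff[OF B'])
qed

text \<open>The homotopy lifts to a map on the connected set \<open>[0,1] \<times> \<real>\<^sup>n\<close>, where the difference of its
  values at \<open>(t, x + l)\<close> and \<open>(t, x)\<close> cannot jump inside the discrete set \<open>\<Lambda>'\<close>.\<close>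

lemma homotopic_lifts_translate_diff:
  assumes B: "lattice_basis B \<Lambda>" and B': "lattice_basis B' \<Lambda>'"
    and hom: "homotopic_with (\<lambda>_. True) (torus_topology \<Lambda>) (torus_topology \<Lambda>') \<phi> \<psi>"
    and F: "lifts_to \<Lambda> \<Lambda>' \<phi> F" and G: "lifts_to \<Lambda> \<Lambda>' \<psi> G" and l: "l \<in> \<Lambda>"
  shows "F (x + l) - F x = G (y + l) - G y"
proof -
  obtain h where h: "continuous_map (prod_topology (top_of_set {0..1::real}) (torus_topology \<Lambda>))
        (torus_topology \<Lambda>') h"
    and h0: "\<And>p. h (0, p) = \<phi> p" and h1: "\<And>p. h (1, p) = \<psi> p"
    using hom unfolding homotopic_with_def by blast
  let ?S = "{0..1::real} \<times> (UNIV :: (real ^ 'a) set)"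
  have "continuous_map (prod_topology (top_of_set {0..1}) euclidean)
      (prod_topology (top_of_set {0..1::real}) (torus_topology \<Lambda>)) (\<lambda>(t, x). (t, torus_point \<Lambda> x))"
    using quotient_imp_continuous_map[OF quotient_map_torus_point[of \<Lambda>]]
    by (simp add: continuous_map_prod_top[where f = "\<lambda>t. t"])
  from continuous_map_compose[OF this h]
  have "continuous_map (top_of_set ?S) (torus_topology \<Lambda>') (h \<circ> (\<lambda>(t, x). (t, torus_point \<Lambda> x)))"
    by (metis prod_topology_subtopology_eu subtopology_UNIV)
  moreover have S: "convex ?S"
    by (intro convex_Times) auto
  ultimately obtain H where H: "continuous_on ?S H"
    "\<And>s. s \<in> ?S \<Longrightarrow> (h \<circ> (\<lambda>(t, x). (t, torus_point \<Lambda> x))) s = torus_point \<Lambda>' (H s)"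
    using torus_lift_exists[OF B' convex_imp_contractible] by blast
  have H_eq: "h (t, torus_point \<Lambda> x) = torus_point \<Lambda>' (H (t, x))" if "t \<in> {0..1}" for t x
    using H(2)[of "(t, x)"] that by simp
  have H_line: "continuous_on UNIV (\<lambda>x. H (t, x))" if "t \<in> {0..1}" for t
    by (rule continuous_on_compose2[OF H(1)]) (use that in \<open>auto intro!: continuous_intros\<close>)
  have const: "H (t, x + l) - H (t, x) = H (s, y + l) - H (s, y)"
    if "t \<in> {0..1}" "s \<in> {0..1}" for t s x y
  proof -
    have "continuous_on ?S (\<lambda>p. H (fst p, snd p + l) - H (fst p, snd p))"
      by (intro continuous_intros continuous_on_compose2[OF H(1)]) auto
    moreover have "H (t, x + l) - H (t, x) \<in> \<Lambda>'" if "t \<in> {0..1}" for t x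
      using H_eq[OF that] torus_point_add_lattice[OF B l] torus_point_eq_iff[OF B'] by metis
    ultimately show ?thesis
      using continuous_into_lattice_constant[OF B' convex_connected[OF S],
          of "\<lambda>p. H (fst p, snd p + l) - H (fst p, snd p)" "(t, x)" "(s, y)"] that
      by force
  qed
  \<comment> \<open>\<open>K\<close> and the slice of \<open>H\<close> at time \<open>t\<close> lift
    the same map, so they differ by a constant lattice vector and have the same translation
    differences.\<close>
  have diff: "K x - H (t, x) = K y - H (t, y)"
    if K: "lifts_to \<Lambda> \<Lambda>' \<rho> K" and t: "t \<in> {0..1}" "\<And>p. h (t, p) = \<rho> p" for \<rho> K t x y
  proof (rule continuous_into_lattice_constant[OF B' connected_UNIV, where f = "\<lambda>x. K x - H (t, x)"])
    show "continuous_on UNIV (\<lambda>x. K x - H (t, x))"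
      using K H_line[OF t(1)] by (auto simp: lifts_to_def intro!: continuous_intros)
    show "range (\<lambda>x. K x - H (t, x)) \<subseteq> \<Lambda>'"
      using K H_eq[OF t(1)] t(2) torus_point_eq_iff[OF B'] unfolding lifts_to_def by auto
  qed auto
  have "F (x + l) - F x = H (0, x + l) - H (0, x)"
    using diff[OF F, of 0 "x + l" x] h0 by (simp add: algebra_simps)
  also have "\<dots> = H (1, y + l) - H (1, y)"
    by (rule const) auto
  also have "\<dots> = G (y + l) - G y"
    using diff[OF G, of 1 "y + l" y] h1 by (simp add: algebra_simps)
  finally show ?thesis .
qed

lemma lifts_to_imp_continuous_map:
  assumes "lifts_to \<Lambda> \<Lambda>' \<phi> F"
  shows "continuous_map (torus_topology \<Lambda>) (torus_topology \<Lambda>') \<phi>"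
proof -
  have "continuous_map euclidean (torus_topology \<Lambda>') (torus_point \<Lambda>' \<circ> F)"
    using assms quotient_imp_continuous_map[OF quotient_map_torus_point] continuous_map_compose
    unfolding lifts_to_def by (metis continuous_map_iff_continuous2)
  moreover have "torus_point \<Lambda>' \<circ> F = \<phi> \<circ> torus_point \<Lambda>"
    using assms by (auto simp: lifts_to_def)
  ultimately show ?thesis
    using continuous_compose_quotient_map[OF quotient_map_torus_point] by metis
qed

text \<open>This is homotopy invariance applied to the constant homotopy.\<close>

lemma lifts_to_translate_diff_const:
  assumes "lattice_basis B \<Lambda>" "lattice_basis B' \<Lambda>'" "lifts_to \<Lambda> \<Lambda>' \<phi> F" "l \<in> \<Lambda>"
  shows "F (x + l) - F x = F (y + l) - F y"
  using homotopic_lifts_translate_diff[OF assms(1,2) _ assms(3,3,4)]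
    lifts_to_imp_continuous_map[OF assms(3)] by (simp add: homotopic_with_equal)

section \<open>Passing between torus maps and their lifts\<close>

lemma lifts_to_exists:
  assumes "lattice_basis B' \<Lambda>'" "continuous_map (torus_topology \<Lambda>) (torus_topology \<Lambda>') \<phi>"
  obtains F where "lifts_to \<Lambda> \<Lambda>' \<phi> F"
proof -
  have "continuous_map (top_of_set UNIV) (torus_topology \<Lambda>') (\<phi> \<circ> torus_point \<Lambda>)"
    using continuous_map_compose[OF quotient_imp_continuous_map[OF quotient_map_torus_point] assms(2)]
    by simp
  then obtain F where "continuous_on UNIV F" "\<And>x. (\<phi> \<circ> torus_point \<Lambda>) x = torus_point \<Lambda>' (F x)"
    using torus_lift_exists[OF assms(1) convex_imp_contractible[OF convex_UNIV]] by (metis UNIV_I)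
  then show ?thesis
    using that by (auto simp: lifts_to_def)
qed

lemma torus_map_from_lift:
  assumes B: "lattice_basis B \<Lambda>" and B': "lattice_basis B' \<Lambda>'" and F: "continuous_on UNIV F"
    and translate: "\<And>l x. l \<in> \<Lambda> \<Longrightarrow> F (x + l) - F x \<in> \<Lambda>'"
  obtains \<phi> where "lifts_to \<Lambda> \<Lambda>' \<phi> F"
proof -
  have "torus_point \<Lambda>' (F x) = torus_point \<Lambda>' (F y)" if "torus_point \<Lambda> x = torus_point \<Lambda> y" for x y
    using that translate[of "x - y" y] by (simp add: torus_point_eq_iff[OF B] torus_point_eq_iff[OF B'])
  then have "torus_point \<Lambda>' (F (inv_into UNIV (torus_point \<Lambda>) (torus_point \<Lambda> x))) = torus_point \<Lambda>' (F x)" for x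
    by (metis f_inv_into_f rangeI)
  then have "lifts_to \<Lambda> \<Lambda>' (\<lambda>p. torus_point \<Lambda>' (F (inv_into UNIV (torus_point \<Lambda>) p))) F"
    using F by (auto simp: lifts_to_def)
  then show ?thesis using that by blast
qed

text \<open>The hypothesis makes \<open>G - F\<close> periodic under \<open>\<Lambda>\<close>, which
  is what the straight-line homotopy from \<open>F\<close> to \<open>G\<close> needs in order to
  descend.\<close>

lemma homotopic_if_equal_translate_diff:
  assumes B: "lattice_basis B \<Lambda>" and B': "lattice_basis B' \<Lambda>'"
    and F: "lifts_to \<Lambda> \<Lambda>' \<phi> F" and G: "lifts_to \<Lambda> \<Lambda>' \<psi> G"
    and eq: "\<And>l x. l \<in> \<Lambda> \<Longrightarrow> F (x + l) - F x = G (x + l) - G x"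
  shows "homotopic_with (\<lambda>_. True) (torus_topology \<Lambda>) (torus_topology \<Lambda>') \<phi> \<psi>"
proof -
  define K where "K = (\<lambda>(t::real, x). F x + t *\<^sub>R (G x - F x))"
  \<comment> \<open>The homotopy is computed at a chosen representative of \<open>p\<close>;
    \<open>h_eq\<close> shows that the choice does not matter.\<close>
  define h where "h = (\<lambda>(t, p). torus_point \<Lambda>' (K (t, inv_into UNIV (torus_point \<Lambda>) p)))"
  let ?q = "\<lambda>(t, x). (t, torus_point \<Lambda> x)"
  let ?X = "prod_topology (top_of_set {0..1::real}) euclidean"
  have h_eq: "h (t, torus_point \<Lambda> x) = torus_point \<Lambda>' (K (t, x))" for t x
  proof -
    let ?y = "inv_into UNIV (torus_point \<Lambda>) (torus_point \<Lambda> x)"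
    have "torus_point \<Lambda> ?y = torus_point \<Lambda> x"
      by (simp add: f_inv_into_f)
    then have "?y - x \<in> \<Lambda>"
      using torus_point_eq_iff[OF B] by blast
    then have "G ?y - F ?y = G x - F x" and F_diff: "F ?y - F x \<in> \<Lambda>'"
      using eq[of "?y - x" x] lifts_to_translate_diff[OF B B' F, of "?y - x" x]
      by (simp_all add: algebra_simps)
    then have "K (t, ?y) - K (t, x) \<in> \<Lambda>'"
      by (simp add: K_def)
    then show ?thesis
      by (simp add: h_def torus_point_eq_iff[OF B'])
  qed
  \<comment> \<open>A product of a quotient map with the identity need not be a quotient map; it is
    one here because the interval is locally compact and Hausdorff.\<close>
  have "compact_space (top_of_set {0..1::real})"
    by (simp add: compact_space_subtopology)
  then have "quotient_map ?X (prod_topology (top_of_set {0..1::real}) (torus_topology \<Lambda>)) ?q"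
    by (intro quotient_map_prod_right quotient_map_torus_point compact_imp_locally_compact_space)
      (auto intro: Hausdorff_space_subtopology)
  moreover have "continuous_map ?X (torus_topology \<Lambda>') (h \<circ> ?q)"
  proof -
    have "continuous_on ({0..1} \<times> UNIV) K"
      using F G unfolding K_def lifts_to_def case_prod_unfold
      by (auto intro!: continuous_intros elim: continuous_on_compose2)
    then have "continuous_map ?X euclidean K"
      by (metis continuous_map_iff_continuous prod_topology_subtopology_eu subtopology_UNIV)
    then have "continuous_map ?X (torus_topology \<Lambda>') (torus_point \<Lambda>' \<circ> K)"
      using quotient_imp_continuous_map[OF quotient_map_torus_point] continuous_map_compose by blast
    moreover have "torus_point \<Lambda>' \<circ> K = h \<circ> ?q"
      using h_eq by auto
    ultimately show ?thesis by simp
  qed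
  ultimately have "continuous_map (prod_topology (top_of_set {0..1::real}) (torus_topology \<Lambda>))
      (torus_topology \<Lambda>') h"
    by (rule continuous_compose_quotient_map)
  moreover have "h (0, p) = \<phi> p" "h (1, p) = \<psi> p" if "p \<in> torus \<Lambda>" for p
    using that F G h_eq by (auto simp: torus_def K_def lifts_to_def)
  ultimately show ?thesis
    by (subst homotopic_with) auto
qed

section \<open>The linear part determined by a lift\<close>

lemma linear_interpolating_translate_diff:
  assumes B: "lattice_basis B \<Lambda>" and B': "lattice_basis B' \<Lambda>'" and F: "lifts_to \<Lambda> \<Lambda>' \<phi> F"
  obtains A where "\<And>l x. l \<in> \<Lambda> \<Longrightarrow> F (x + l) - F x = A *v l"
proof -
  obtain C where C: "\<And>x. B *v (C *v x) = x" "\<And>x. C *v (B *v x) = x"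
    "\<And>x. x \<in> \<Lambda> \<longleftrightarrow> C *v x \<in> int_vecs"
    using lattice_basis_inverse[OF B] by blast
  \<comment> \<open>The columns of \<open>R\<close> are the translation differences along the
    lattice basis, so \<open>R\<close> acts on lattice coordinates; composing with \<open>C\<close>
    gives the required matrix.\<close>
  define R where "R = (\<chi> i j. (F (B *v axis j 1) - F 0) $ i)"
  have R_axis: "R *v axis j 1 = F (B *v axis j 1) - F 0" for j
    by (simp add: matrix_vector_mult_basis column_def R_def vec_eq_iff)
  \<comment> \<open>The base point \<open>x\<close> stays arbitrary because the inductive steps for
    sums and negatives move it.\<close>
  have R: "F (x + B *v z) - F x = R *v z" if "z \<in> int_vecs" for x z
    using that
  proof (induction z arbitrary: x rule: int_vecs_induct)
    case (axis j)
    have "axis j 1 \<in> int_vecs"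
      by (simp add: int_vecs_def axis_def)
    then have "B *v axis j 1 \<in> \<Lambda>"
      by (simp add: C)
    then show ?case
      using lifts_to_translate_diff_const[OF B B' F, of "B *v axis j 1" x 0] R_axis by simp
  next
    case (add u v)
    have "F (x + B *v (u + v)) - F x
        = (F ((x + B *v u) + B *v v) - F (x + B *v u)) + (F (x + B *v u) - F x)"
      by (simp add: matrix_vector_right_distrib add.assoc)
    then show ?case
      unfolding add by (simp add: matrix_vector_right_distrib)
  next
    case (uminus u)
    show ?case
      using uminus[of "x - B *v u"] by (simp add: vec.neg algebra_simps)
  qed
  have "F (x + l) - F x = (R ** C) *v l" if "l \<in> \<Lambda>" for l x
    using R[of "C *v l" x] that C by (simp add: matrix_vector_mul_assoc[symmetric])
  then show ?thesis using that by blast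
qed

text \<open>A lattice contains a basis of the whole space. This gives uniqueness of the linear
  part.\<close>

lemma lattice_linear_eq:
  assumes B: "lattice_basis B \<Lambda>" and eq: "\<And>l. l \<in> \<Lambda> \<Longrightarrow> A *v l = A' *v l"
  shows "A = A'"
proof -
  obtain C where C: "\<And>x. B *v (C *v x) = x" "\<And>x. C *v (B *v x) = x"
    "\<And>x. x \<in> \<Lambda> \<longleftrightarrow> C *v x \<in> int_vecs"
    using lattice_basis_inverse[OF B] by blast
  have "B *v axis j 1 \<in> \<Lambda>" for j
    unfolding C(2,3) by (simp add: int_vecs_def axis_def)
  from eq[OF this] have "(A ** B) *v axis j 1 = (A' ** B) *v axis j 1" for j
    by (simp add: matrix_vector_mul_assoc)
  then have "column j (A ** B) = column j (A' ** B)" for j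
    by (simp only: matrix_vector_mult_basis)
  then have "A ** B = A' ** B"
    by (simp add: column_def vec_eq_iff)
  then have "A *v x = A' *v x" for x
    using C(1)[of x] by (metis matrix_vector_mul_assoc)
  then show ?thesis
    by (simp add: matrix_eq)
qed

section \<open>Lipschitz constants\<close>

lemma torus_dist_le_lipschitz_const:
  assumes "lipschitz_const \<Lambda> \<phi> \<le> ennreal L" "0 \<le> L" "p \<in> torus \<Lambda>" "q \<in> torus \<Lambda>"
    and pos: "0 < torus_dist p q"
  shows "torus_dist (\<phi> p) (\<phi> q) \<le> L * torus_dist p q"
proof -
  have "p \<noteq> q"
    using pos by (auto simp: setdist_refl)
  then have "ennreal (torus_dist (\<phi> p) (\<phi> q) / torus_dist p q) \<le> lipschitz_const \<Lambda> \<phi>"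
    unfolding lipschitz_const_def using assms(3,4) by (intro SUP_upper2[of "(p, q)"]) auto
  also have "\<dots> \<le> ennreal L" by fact
  finally have "torus_dist (\<phi> p) (\<phi> q) / torus_dist p q \<le> L"
    using assms(2) by simp
  then show ?thesis
    using pos by (simp add: field_simps)
qed

text \<open>The flat distances only agree with the Euclidean one at small scale, so the segment from
  \<open>x\<close> to \<open>y\<close> is cut into short pieces.\<close>

lemma lift_lipschitz:
  assumes B: "lattice_basis B \<Lambda>" and B': "lattice_basis B' \<Lambda>'" and F: "lifts_to \<Lambda> \<Lambda>' \<phi> F"
    and L: "lipschitz_const \<Lambda> \<phi> \<le> ennreal L" "0 \<le> L"
  shows "dist (F x) (F y) \<le> L * dist x y"
proof -
  obtain e where e: "e > 0"
    "\<And>x y. dist x y \<le> e \<Longrightarrow> torus_dist (torus_point \<Lambda> x) (torus_point \<Lambda> y) = dist x y"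
    using torus_dist_eq_dist_local[OF B] by blast
  obtain e' where e': "e' > 0"
    "\<And>x y. dist x y \<le> e' \<Longrightarrow> torus_dist (torus_point \<Lambda>' x) (torus_point \<Lambda>' y) = dist x y"
    using torus_dist_eq_dist_local[OF B'] by blast
  \<comment> \<open>With both source and image points this close, the torus distances may be
    replaced by Euclidean ones on both sides.\<close>
  have local: "dist (F u) (F v) \<le> L * dist u v" if "dist u v \<le> e" "dist (F u) (F v) \<le> e'" for u v
  proof (cases "u = v")
    case False
    have "torus_dist (\<phi> (torus_point \<Lambda> u)) (\<phi> (torus_point \<Lambda> v))
        \<le> L * torus_dist (torus_point \<Lambda> u) (torus_point \<Lambda> v)"
      using False e(2)[OF that(1)]
      by (intro torus_dist_le_lipschitz_const[OF L]) (auto simp: torus_def)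
    then show ?thesis
      using F e(2)[OF that(1)] e'(2)[OF that(2)] by (simp add: lifts_to_def)
  qed simp
  \<comment> \<open>The local estimate also requires close images; uniform continuity on the compact
    segment supplies this with one \<open>d\<close> for all pieces.\<close>
  have "uniformly_continuous_on (closed_segment x y) F"
    using F continuous_on_subset unfolding lifts_to_def
    by (intro compact_uniformly_continuous) auto
  then obtain d where d: "d > 0"
    "\<And>u v. u \<in> closed_segment x y \<Longrightarrow> v \<in> closed_segment x y \<Longrightarrow> dist v u < d \<Longrightarrow> dist (F v) (F u) < e'"
    using e'(1) unfolding uniformly_continuous_on_def by meson
  define r where "r = min (d / 2) e"
  have r: "r > 0" "r < d" "r \<le> e"
    using d(1) e(1) by (auto simp: r_def)
  \<comment> \<open>The strict inequality forces \<open>n\<close> to be positive even if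
    \<open>x = y\<close>, so the division by \<open>n\<close> below is safe.\<close>
  obtain n where n: "dist x y / r < real n"
    using reals_Archimedean2 by blast
  have "0 \<le> dist x y / r"
    using r by simp
  with n have n0: "real n > 0"
    by linarith
  define p where "p k = x + (real k / real n) *\<^sub>R (y - x)" for k
  have p_seg: "p k \<in> closed_segment x y" if "k \<le> n" for k
    unfolding in_segment p_def using that n0
    by (intro exI[of _ "real k / real n"]) (auto simp: algebra_simps)
  have p_dist: "dist (p (Suc k)) (p k) = dist x y / real n" for k
  proof -
    have "p (Suc k) - p k = (1 / real n) *\<^sub>R (y - x)"
      by (simp add: p_def add_divide_distrib algebra_simps)
    then show ?thesis
      using n0 by (simp add: dist_norm norm_minus_commute)
  qed
  have step: "dist (F (p (Suc k))) (F (p k)) \<le> L * (dist x y / real n)" if "Suc k \<le> n" for k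
  proof -
    have "dist x y / real n \<le> r"
      using n n0 r(1) by (simp add: field_simps)
    then have "dist (p (Suc k)) (p k) \<le> e" "dist (p (Suc k)) (p k) < d"
      using r p_dist by auto
    then show ?thesis
      using local d(2)[OF p_seg p_seg] that p_dist by (metis Suc_leD less_imp_le)
  qed
  \<comment> \<open>The step estimates are summed by the triangle inequality; \<open>k = n\<close>
    gives the claim, since \<open>p n = y\<close>.\<close>
  have "dist (F (p k)) (F x) \<le> real k * (L * (dist x y / real n))" if "k \<le> n" for k
    using that
  proof (induction k)
    case (Suc k)
    have "dist (F (p (Suc k))) (F x) \<le> dist (F (p (Suc k))) (F (p k)) + dist (F (p k)) (F x)"
      by (rule dist_triangle)
    then show ?case
      using Suc step[of k] by (simp add: algebra_simps add_divide_distrib)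
  qed (simp add: p_def)
  from this[of n] show ?thesis
    using n0 by (simp add: p_def dist_commute)
qed

text \<open>Multiples of lattice vectors are dense, so a homogeneous closed condition can be checked on
  the lattice.\<close>

lemma linear_norm_bound_from_lattice:
  fixes A :: "real ^ 'n ^ 'n"
  assumes B: "lattice_basis B \<Lambda>" and bound: "\<And>l. l \<in> \<Lambda> \<Longrightarrow> norm (A *v l) \<le> L * norm l"
  shows "norm (A *v x) \<le> L * norm x"
proof -
  obtain C where C: "\<And>x. B *v (C *v x) = x" "\<And>x. C *v (B *v x) = x"
    "\<And>x. x \<in> \<Lambda> \<longleftrightarrow> C *v x \<in> int_vecs"
    using lattice_basis_inverse[OF B] by blast
  \<comment> \<open>Rounding down the coordinates of \<open>k\<close> times \<open>x\<close> gives a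
    lattice point; after division by \<open>k\<close> the rounding error in each coordinate is at
    most \<open>1 / k\<close>.\<close>
  define z :: "nat \<Rightarrow> real ^ 'n" where "z k = (\<chi> i. of_int \<lfloor>real k * (C *v x) $ i\<rfloor>)" for k
  define v where "v k = B *v (inverse (real k) *\<^sub>R z k)" for k
  have "(\<lambda>k. inverse (real k) *\<^sub>R z k) \<longlonglongrightarrow> C *v x"
  proof (rule vec_tendstoI)
    fix i
    define c where "c = (C *v x) $ i"
    have "(\<lambda>k. inverse (real k) * of_int \<lfloor>real k * c\<rfloor>) \<longlonglongrightarrow> c"
    proof (rule LIM_zero_cancel, rule Lim_null_comparison)
      show "(\<lambda>k. inverse (real k)) \<longlonglongrightarrow> 0"
        by (rule lim_inverse_n)
      show "\<forall>\<^sub>F k in sequentially. norm (inverse (real k) * of_int \<lfloor>real k * c\<rfloor> - c) \<le> inverse (real k)"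
      proof (rule eventually_sequentiallyI[of 1])
        fix k :: nat assume k: "1 \<le> k"
        have "inverse (real k) * of_int \<lfloor>real k * c\<rfloor> - c = inverse (real k) * (of_int \<lfloor>real k * c\<rfloor> - real k * c)"
          using k by (simp add: field_simps)
        also have "norm \<dots> \<le> inverse (real k) * 1"
          unfolding norm_mult by (intro mult_mono) (use k in auto, linarith)
        finally show "norm (inverse (real k) * of_int \<lfloor>real k * c\<rfloor> - c) \<le> inverse (real k)"
          by simp
      qed
    qed
    then show "(\<lambda>k. (inverse (real k) *\<^sub>R z k) $ i) \<longlonglongrightarrow> (C *v x) $ i"
      by (simp add: z_def c_def)
  qed
  then have "v \<longlonglongrightarrow> B *v (C *v x)"
    unfolding v_def by (rule bounded_linear.tendsto[OF matrix_vector_mul_bounded_linear])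
  then have v: "v \<longlonglongrightarrow> x"
    by (simp add: C)
  have "norm (A *v v k) \<le> L * norm (v k)" for k
  proof -
    have "z k \<in> int_vecs"
      by (simp add: z_def int_vecs_def)
    then have "inverse (real k) * norm (A *v (B *v z k)) \<le> inverse (real k) * (L * norm (B *v z k))"
      by (intro mult_left_mono bound) (auto simp: C)
    then show ?thesis
      by (simp add: v_def matrix_vector_mult_scaleR algebra_simps)
  qed
  moreover have "(\<lambda>k. norm (A *v v k)) \<longlonglongrightarrow> norm (A *v x)"
    by (intro tendsto_norm bounded_linear.tendsto[OF matrix_vector_mul_bounded_linear v])
  moreover have "(\<lambda>k. L * norm (v k)) \<longlonglongrightarrow> L * norm x"
    by (intro tendsto_intros v)
  ultimately show ?thesis
    by (meson LIMSEQ_le)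
qed

section \<open>Lipschitz constants of maps with affine lifts\<close>

text \<open>The Euclidean bound holds for every choice of representatives, hence for the infimum
  that defines the distance in the source torus.\<close>

lemma affine_lipschitz_const_le:
  assumes B: "lattice_basis B \<Lambda>" and B': "lattice_basis B' \<Lambda>'"
    and lift: "lifts_to \<Lambda> \<Lambda>' \<psi> (\<lambda>x. A *v x + b)"
    and A: "\<And>x. norm (A *v x) \<le> L * norm x" and "0 \<le> L"
  shows "lipschitz_const \<Lambda> \<psi> \<le> ennreal L"
proof -
  have *: "torus_dist (\<psi> p) (\<psi> q) \<le> L * dist x y" if "p = torus_point \<Lambda> x" "q = torus_point \<Lambda> y" for p q x y
  proof -
    have "torus_dist (\<psi> p) (\<psi> q) \<le> dist (A *v x + b) (A *v y + b)"
      using lift that torus_dist_le_dist[OF B'] unfolding lifts_to_def by metis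
    also have "\<dots> \<le> L * dist x y"
      using A[of "x - y"] by (simp add: dist_norm matrix_vector_mult_diff_distrib)
    finally show ?thesis .
  qed
  have "torus_dist (\<psi> p) (\<psi> q) / torus_dist p q \<le> L" if pq: "p \<in> torus \<Lambda>" "q \<in> torus \<Lambda>" for p q
  \<comment> \<open>If the denominator is 0, the quotient is 0 by convention; if
    \<open>L = 0\<close>, the numerator vanishes. Otherwise division by \<open>L\<close> is
    allowed.\<close>
  proof (cases "torus_dist p q = 0 \<or> L = 0")
    case True
    obtain x y where "p = torus_point \<Lambda> x" "q = torus_point \<Lambda> y"
      using pq by (auto simp: torus_def)
    then have "L = 0 \<Longrightarrow> torus_dist (\<psi> p) (\<psi> q) = 0"
      using *[of p x q y] by (simp add: antisym)
    then show ?thesis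
      using True \<open>0 \<le> L\<close> by auto
  next
    case False
    \<comment> \<open>With \<open>L\<close> moved to the left, it suffices to bound the distance of
      each pair of representatives from below; \<open>coset\<close> lets any elements of
      \<open>p\<close> and \<open>q\<close> serve as representatives.\<close>
    have "torus_dist (\<psi> p) (\<psi> q) / L \<le> torus_dist p q"
    proof (rule le_setdistI)
      show "p \<noteq> {}" "q \<noteq> {}"
        using pq lattice_basis_zero[OF B] by (auto simp: torus_def torus_point_def)
      fix u v assume uv: "u \<in> p" "v \<in> q"
      have coset: "p = torus_point \<Lambda> u" if "p \<in> torus \<Lambda>" "u \<in> p" for p u
      proof -
        obtain x l where "p = torus_point \<Lambda> x" "l \<in> \<Lambda>" "u = x + l"
          using \<open>p \<in> torus \<Lambda>\<close> \<open>u \<in> p\<close> by (auto simp: torus_def torus_point_def)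
        then show ?thesis
          using torus_point_add_lattice[OF B] by simp
      qed
      show "torus_dist (\<psi> p) (\<psi> q) / L \<le> dist u v"
        using *[OF coset[OF pq(1) uv(1)] coset[OF pq(2) uv(2)]] False \<open>0 \<le> L\<close>
        by (simp add: field_simps)
    qed
    moreover have "0 < torus_dist p q"
      using False by (simp add: order_less_le)
    ultimately show ?thesis
      using False \<open>0 \<le> L\<close> by (simp add: field_simps)
  qed
  then show ?thesis
    unfolding lipschitz_const_def by (intro SUP_least) (auto intro: ennreal_leI)
qed

text \<open>By homotopy invariance the vectors \<open>A *v l\<close> are displacements of any lift
  of \<open>\<phi>\<close>, so a Lipschitz bound for \<open>\<phi>\<close> bounds \<open>A\<close>
  on the lattice, hence everywhere. An infinite constant of \<open>\<phi>\<close> leaves nothing to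
  prove.\<close>

lemma affine_lipschitz_const_minimal:
  assumes B: "lattice_basis B \<Lambda>" and B': "lattice_basis B' \<Lambda>'"
    and hom: "homotopic_with (\<lambda>_. True) (torus_topology \<Lambda>) (torus_topology \<Lambda>') \<psi> \<phi>"
    and \<psi>: "lifts_to \<Lambda> \<Lambda>' \<psi> (\<lambda>x. A *v x + b)"
  shows "lipschitz_const \<Lambda> \<psi> \<le> lipschitz_const \<Lambda> \<phi>"
proof (cases "lipschitz_const \<Lambda> \<phi>")
  case (real L)
  obtain F where F: "lifts_to \<Lambda> \<Lambda>' \<phi> F"
    using lifts_to_exists[OF B'] homotopic_with_imp_continuous_maps[OF hom] by blast
  have "norm (A *v l) \<le> L * norm l" if l: "l \<in> \<Lambda>" for l
  proof -
    have "A *v l = F (0 + l) - F 0"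
      using homotopic_lifts_translate_diff[OF B B' hom \<psi> F l, of 0 0] by simp
    then show ?thesis
      using lift_lipschitz[OF B B' F _ real(1), of "0 + l" 0] real(2) by (simp add: dist_norm)
  qed
  from linear_norm_bound_from_lattice[OF B this] show ?thesis
    using affine_lipschitz_const_le[OF B B' \<psi> _ real(1)] real(2) by simp
qed simp

text \<open>Composing with a translation of the target torus stays in the homotopy class, so the
  affine lift is unique once its value \<open>b\<close> at the origin is fixed. Minimality is
  claimed for every map in the class with an affine lift.\<close>

theorem proposition4p1:
  fixes X X' :: "'n::finite marked set"
    and \<Lambda> \<Lambda>' :: "(real ^ 'n) set"
    and f f' :: "(real ^ 'n) set \<Rightarrow> (real ^ 'n) set"
  assumes "CARD('n) \<ge> 2"
    and "X \<in> teichmueller_space" and "(\<Lambda>, f) \<in> X"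
    and "X' \<in> teichmueller_space" and "(\<Lambda>', f') \<in> X'"
  shows "(\<forall>b. \<exists>!\<Psi>. affine_map \<Psi> \<and> \<Psi> 0 = b \<and>
              (\<exists>\<psi> \<in> change_of_marking (\<Lambda>, f) (\<Lambda>', f'). lifts_to \<Lambda> \<Lambda>' \<psi> \<Psi>)) \<and>
         (\<forall>\<psi> \<in> change_of_marking (\<Lambda>, f) (\<Lambda>', f').
            (\<exists>\<Psi>. affine_map \<Psi> \<and> lifts_to \<Lambda> \<Lambda>' \<psi> \<Psi>) \<longrightarrow>
            (\<forall>\<phi> \<in> change_of_marking (\<Lambda>, f) (\<Lambda>', f').
               lipschitz_const \<Lambda> \<psi> \<le> lipschitz_const \<Lambda> \<phi>))"
proof -
  let ?hom = "homotopic_with (\<lambda>_. True) (torus_topology \<Lambda>) (torus_topology \<Lambda>')"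
  define g where "g = inv_into (torus \<Lambda>') f' \<circ> f"
  have class_iff: "\<phi> \<in> change_of_marking (\<Lambda>, f) (\<Lambda>', f') \<longleftrightarrow> ?hom g \<phi>" for \<phi>
    by (simp add: change_of_marking_def g_def)
  have class_hom: "?hom \<phi> \<psi>"
    if "\<phi> \<in> change_of_marking (\<Lambda>, f) (\<Lambda>', f')" "\<psi> \<in> change_of_marking (\<Lambda>, f) (\<Lambda>', f')" for \<phi> \<psi>
    using that class_iff homotopic_with_trans homotopic_with_symD by metis
  \<comment> \<open>Each point of the quotient is a class of \<open>marking_equiv\<close>, which
    relates only marked tori.\<close>
  have marked: "(\<Lambda>, f) \<in> marked_tori" "(\<Lambda>', f') \<in> marked_tori"
    using assms(2-5) by (auto simp: teichmueller_space_def quotient_def marking_equiv_def)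
  then obtain B B' where B: "lattice_basis B \<Lambda>" and B': "lattice_basis B' \<Lambda>'"
    by (auto simp: marked_tori_def unit_volume_lattice_def)
  have f: "homeomorphic_map (torus_topology \<Lambda>) (torus_topology int_vecs) f"
    and f': "homeomorphic_map (torus_topology \<Lambda>') (torus_topology int_vecs) f'"
    using marked by (auto simp: marked_tori_def)
  have "continuous_map (torus_topology int_vecs) (torus_topology \<Lambda>') (inv_into (torus \<Lambda>') f')"
  proof -
    obtain k where k: "homeomorphic_maps (torus_topology \<Lambda>') (torus_topology int_vecs) f' k"
      using f' homeomorphic_map_maps by blast
    moreover have "inj_on f' (torus \<Lambda>')"
      using f' by (simp add: homeomorphic_eq_everything_map)
    ultimately have inv: "inv_into (torus \<Lambda>') f' p = k p" if "p \<in> torus int_vecs" for p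
      using that by (intro inv_into_f_eq) (auto simp: homeomorphic_maps_def continuous_map_def)
    \<comment> \<open>Continuity passes from the topological inverse \<open>k\<close> to
      \<open>inv_into\<close>, as the two agree on the torus.\<close>
    have "continuous_map (torus_topology int_vecs) (torus_topology \<Lambda>') k"
      using k by (simp add: homeomorphic_maps_def)
    then show ?thesis
      by (rule continuous_map_eq) (simp add: inv)
  qed
  then have "continuous_map (torus_topology \<Lambda>) (torus_topology \<Lambda>') g"
    unfolding g_def using homeomorphic_imp_continuous_map[OF f] continuous_map_compose by blast
  then obtain G where G: "lifts_to \<Lambda> \<Lambda>' g G"
    using lifts_to_exists[OF B'] by blast
  obtain A where A: "\<And>l x. l \<in> \<Lambda> \<Longrightarrow> G (x + l) - G x = A *v l"
    using linear_interpolating_translate_diff[OF B B' G] by blast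
  \<comment> \<open>Any affine lift of a map in the class has the translation differences of
    \<open>G\<close>, and for an affine map these are the values of its linear part on the
    lattice.\<close>
  have linear_part: "A' = A"
    if "\<psi> \<in> change_of_marking (\<Lambda>, f) (\<Lambda>', f')" "lifts_to \<Lambda> \<Lambda>' \<psi> (\<lambda>x. A' *v x + b)" for A' \<psi> b
  proof (rule lattice_linear_eq[OF B])
    fix l assume "l \<in> \<Lambda>"
    then show "A' *v l = A *v l"
      using homotopic_lifts_translate_diff[OF B B' _ G that(2), of l 0 0] A[of l 0] that(1) class_iff
      by simp
  qed
  have "\<exists>\<psi> \<in> change_of_marking (\<Lambda>, f) (\<Lambda>', f'). lifts_to \<Lambda> \<Lambda>' \<psi> (\<lambda>x. A *v x + b)" for b
  proof -
    have diff: "(A *v (x + l) + b) - (A *v x + b) = G (x + l) - G x" if "l \<in> \<Lambda>" for x l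
      using A[OF that, of x] by (simp add: matrix_vector_right_distrib)
    obtain \<psi> where \<psi>: "lifts_to \<Lambda> \<Lambda>' \<psi> (\<lambda>x. A *v x + b)"
    proof (rule torus_map_from_lift[OF B B'])
      show "continuous_on UNIV (\<lambda>x. A *v x + b)"
        by (intro continuous_intros matrix_vector_mult_linear_continuous_on)
      show "(A *v (x + l) + b) - (A *v x + b) \<in> \<Lambda>'" if "l \<in> \<Lambda>" for l x
        using lifts_to_translate_diff[OF B B' G that] diff[OF that] by simp
    qed
    have "?hom g \<psi>"
      using homotopic_if_equal_translate_diff[OF B B' G \<psi>] diff by simp
    then show ?thesis
      using \<psi> class_iff by blast
  qed
  then have "\<exists>!\<Psi>. affine_map \<Psi> \<and> \<Psi> 0 = b \<and>
      (\<exists>\<psi> \<in> change_of_marking (\<Lambda>, f) (\<Lambda>', f'). lifts_to \<Lambda> \<Lambda>' \<psi> \<Psi>)" for b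
    by (intro ex1I[of _ "\<lambda>x. A *v x + b"]) (use linear_part in \<open>auto simp: affine_map_def\<close>)
  moreover have "lipschitz_const \<Lambda> \<psi> \<le> lipschitz_const \<Lambda> \<phi>"
    if "\<psi> \<in> change_of_marking (\<Lambda>, f) (\<Lambda>', f')" "affine_map \<Psi>" "lifts_to \<Lambda> \<Lambda>' \<psi> \<Psi>"
      "\<phi> \<in> change_of_marking (\<Lambda>, f) (\<Lambda>', f')" for \<psi> \<phi> \<Psi>
    using that affine_lipschitz_const_minimal[OF B B' class_hom[OF that(1,4)]]
    by (auto simp: affine_map_def)
  ultimately show ?thesis by blast
qed

end
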